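(* Let $b\ge 2$ be an integer, let $T=(t_1,\ldots,t_b)$ be a $b$-tuple of positive integers, let $w_T(n|z_1,\ldots,z_b)$ be the base $b$ Stern polynomials, and let $(a_k)_{k\ge 2}$ be the base $b$ Jacobsthal numbers. Then for all integers $l\ge 2$, $$w_T(a_{2l+1}|z_1,\ldots,z_b)=z_b\,w_T(a_{2l}|z_1^{t_1},\ldots,z_b^{t_b})+z_1^{t_1}\,w_T(a_{2l-1}|z_1^{t_1^2},\ldots,z_b^{t_b^2}),$$ and for all integers $l\ge 1$, $$w_T(a_{2l+2}|z_1,\ldots,z_b)=w_T(a_{2l+1}|z_1^{t_1},\ldots,z_b^{t_b})+z_b\,z_{b-1}^{t_{b-1}}\,w_T(a_{2l}|z_1^{t_1^2},\ldots,z_b^{t_b^2}).$$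
   Context: Fix an integer $b\ge 2$ and a tuple $T=(t_1,\ldots,t_b)$ of positive integers. The base $b$ Stern polynomials $w_T(n|z_1,\ldots,z_b)\in\mathbb{Z}[z_1,\ldots,z_b]$ are defined by $w_T(0|z_1,\ldots,z_b)=0$, $w_T(1|z_1,\ldots,z_b)=1$, and for $n\ge 1$ by $$w_T(b(n-1)+j+1|z_1,\ldots,z_b)=z_j\,w_T(n|z_1^{t_1},\ldots,z_b^{t_b})\quad(1\le j\le b-1),$$ $$w_T(bn+1|z_1,\ldots,z_b)=z_b\,w_T(n|z_1^{t_1},\ldots,z_b^{t_b})+w_T(n+1|z_1^{t_1},\ldots,z_b^{t_b}).$$ Here $z_j^{t_j^i}$ means $z_j$ raised to the power $(t_j)^i$. The base $b$ Jacobsthal numbers are, for $k\ge 2$, $$a_k=\frac{b^k-1}{b^2-1}+\left(\frac{1-(-1)^k}{2}\right)\frac{b}{b+1}.$$ These are integers; their base $b$ expansions are $a_{2l}=((10)^{l-1}1)_b$ and $a_{2l+1}=((10)^{l-1}11)_b$ for $l\ge 1$, where $(10)^{l-1}$ denotes the digit block $10$ repeated $l-1$ times. *)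

theory Defs
  imports Complex_Main "HOL-Library.Poly_Mapping"
begin

text \<open>Polynomials with integer coefficients in the variables \<open>z\<^sub>j\<close>, \<open>j\<close> a natural number: an
  exponent vector is a finitely supported function, and so is a polynomial.\<close>

type_synonym int_mpoly = "(nat \<Rightarrow>\<^sub>0 nat) \<Rightarrow>\<^sub>0 int"

definition Z :: "nat \<Rightarrow> int_mpoly" where
  "Z j = Poly_Mapping.single (Poly_Mapping.single j 1) 1"

text \<open>The result \<open>p(f\<^sub>1, f\<^sub>2, \<dots>)\<close> of replacing each variable \<open>z\<^sub>j\<close> in \<open>p\<close> by the polynomial \<open>f j\<close>.\<close>

definition poly_subst :: "(nat \<Rightarrow> int_mpoly) \<Rightarrow> int_mpoly \<Rightarrow> int_mpoly" where
  "poly_subst f p =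
     (\<Sum>m\<in>Poly_Mapping.keys p. of_int (Poly_Mapping.lookup p m) *
        (\<Prod>j\<in>Poly_Mapping.keys m. f j ^ Poly_Mapping.lookup m j))"

text \<open>The tuple \<open>(t\<^sub>1, \<dots>, t\<^sub>b)\<close> is a function of which only the values on \<open>{1..b}\<close> matter, since
  no other variables occur (lemma \<open>stern_vars\<close>). For \<open>n \<ge> 2\<close> the recursion splits
  \<open>n - 1 = b * q + j\<close> with \<open>0 \<le> j < b\<close>; lemmas \<open>stern_rec_digit\<close> and \<open>stern_rec_one\<close> give the
  usual form. The value for \<open>b < 2\<close> is a dummy needed for termination only.\<close>

function stern :: "nat \<Rightarrow> (nat \<Rightarrow> nat) \<Rightarrow> nat \<Rightarrow> int_mpoly" where
  "stern b t n =
     (if b < 2 \<or> n = 0 then 0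
      else if n = 1 then 1
      else let q = (n - 1) div b; j = (n - 1) mod b
           in if j = 0
              then Z b * poly_subst (\<lambda>i. Z i ^ t i) (stern b t q)
                   + poly_subst (\<lambda>i. Z i ^ t i) (stern b t (q + 1))
              else Z j * poly_subst (\<lambda>i. Z i ^ t i) (stern b t (q + 1)))"
  by auto
termination
proof (relation "measure (\<lambda>(b, t, n). n)", goal_cases)
  case 1
  show ?case by simp
next
  case (2 b t n q j)
  then have "q \<le> n - 1" by (simp only: div_le_dividend)
  with 2 have "q < n" by linarith
  then show ?case by simp
next
  case (3 b t n q j)
  then have "q < n - 1" by (simp add: div_less_dividend)
  then show ?case by simp
next
  case (4 b t n q j)
  then have "q < n - 1" by (simp add: div_less_dividend)
  then show ?case by simp
qed

declare stern.simps [simp del]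

lemma stern_0: "stern b t 0 = 0"
  by (simp add: stern.simps)

lemma stern_1: "2 \<le> b \<Longrightarrow> stern b t 1 = 1"
  by (simp add: stern.simps)

lemma stern_rec_digit:
  assumes "2 \<le> b" "1 \<le> n" "1 \<le> j" "j \<le> b - 1"
  shows "stern b t (b * (n - 1) + j + 1) = Z j * poly_subst (\<lambda>i. Z i ^ t i) (stern b t n)"
proof -
  have "j < b" using assms by simp
  then have "(b * (n - 1) + j) div b = n - 1" "(b * (n - 1) + j) mod b = j"
    using assms by simp_all
  then show ?thesis
    using assms by (subst stern.simps) (simp add: Let_def)
qed

lemma stern_rec_one:
  assumes "2 \<le> b" "1 \<le> n"
  shows "stern b t (b * n + 1) =
    Z b * poly_subst (\<lambda>i. Z i ^ t i) (stern b t n) + poly_subst (\<lambda>i. Z i ^ t i) (stern b t (n + 1))"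
  using assms by (subst stern.simps) (simp add: Let_def)

lemma stern_vars:
  assumes "m \<in> Poly_Mapping.keys (stern b t n)"
  shows "Poly_Mapping.keys m \<subseteq> {1..b}"
proof -
  define P where "P = {p :: int_mpoly. \<forall>m\<in>Poly_Mapping.keys p. Poly_Mapping.keys m \<subseteq> {1..b}}"
  have P_single: "Poly_Mapping.single m c \<in> P" if "Poly_Mapping.keys m \<subseteq> {1..b}" for m c
    using that by (simp add: P_def)
  have P_0: "0 \<in> P" by (simp add: P_def)
  have P_1: "1 \<in> P" by (simp add: P_def)
  have P_add: "p + q \<in> P" if "p \<in> P" "q \<in> P" for p q
    using that Poly_Mapping.keys_add[of p q] unfolding P_def by blast
  have P_mult: "p * q \<in> P" if "p \<in> P" "q \<in> P" for p q
  proof -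
    have "Poly_Mapping.keys (x + y) \<subseteq> {1..b}"
      if "x \<in> Poly_Mapping.keys p" "y \<in> Poly_Mapping.keys q" for x y
      using that \<open>p \<in> P\<close> \<open>q \<in> P\<close> Poly_Mapping.keys_add[of x y] unfolding P_def by blast
    then show ?thesis
      using keys_mult[of p q] unfolding P_def by blast
  qed
  have P_power: "p ^ k \<in> P" if "p \<in> P" for p k
    by (induction k) (auto simp: P_1 intro: P_mult that)
  have P_of_int: "of_int c \<in> P" for c
  proof -
    have "(of_int c :: int_mpoly) = Poly_Mapping.single 0 c"
      by (simp flip: single_of_int)
    then show ?thesis by (simp add: P_single)
  qed
  have P_prod: "prod f A \<in> P" if "\<And>x. x \<in> A \<Longrightarrow> f x \<in> P" for f and A :: "nat set"
    using that by (induction A rule: infinite_finite_induct) (auto simp: P_1 intro: P_mult)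
  have P_sum: "sum f A \<in> P" if "\<And>x. x \<in> A \<Longrightarrow> f x \<in> P" for f and A :: "(nat \<Rightarrow>\<^sub>0 nat) set"
    using that by (induction A rule: infinite_finite_induct) (auto simp: P_0 intro: P_add)
  have P_Z: "Z j \<in> P" if "j \<in> {1..b}" for j
    unfolding Z_def by (rule P_single) (use that in simp)
  have P_subst: "poly_subst (\<lambda>i. Z i ^ t i) p \<in> P" if "p \<in> P" for p
    unfolding poly_subst_def
  proof (intro P_sum P_mult P_of_int P_prod P_power P_Z)
    fix m j
    assume "m \<in> Poly_Mapping.keys p" "j \<in> Poly_Mapping.keys m"
    with that show "j \<in> {1..b}" unfolding P_def by blast
  qed
  have "stern b t n \<in> P"
  proof (induction n rule: less_induct)
    case (less n)
    show ?case
    proof (cases "b < 2 \<or> n = 0 \<or> n = 1")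
      case True
      then show ?thesis by (auto simp: stern.simps P_0 P_1)
    next
      case False
      define q j where "q = (n - 1) div b" and "j = (n - 1) mod b"
      have "q < n - 1" using False by (simp add: q_def)
      then have IH: "stern b t q \<in> P" "stern b t (q + 1) \<in> P" using less by auto
      have "j < b" using False by (simp add: j_def)
      then have Zj: "Z j \<in> P" if "j \<noteq> 0" using that by (intro P_Z) auto
      have Zb: "Z b \<in> P" using False by (intro P_Z) auto
      show ?thesis
        using False Zj Zb IH
        by (subst stern.simps)
          (auto simp: Let_def q_def j_def intro!: P_add P_mult P_subst)
    qed
  qed
  then show ?thesis using assms unfolding P_def by blast
qed

text \<open>The rounding in the definition is only a change of type: lemma \<open>of_nat_jacobsthal\<close> shows that
  the defining rational number is already a natural number.\<close>

definition jacobsthal_rat :: "nat \<Rightarrow> nat \<Rightarrow> rat" where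
  "jacobsthal_rat b k =
     (of_nat b ^ k - 1) / (of_nat b ^ 2 - 1) + (1 - (-1) ^ k) / 2 * (of_nat b / (of_nat b + 1))"

definition jacobsthal :: "nat \<Rightarrow> nat \<Rightarrow> nat" where
  "jacobsthal b k = nat \<lfloor>jacobsthal_rat b k\<rfloor>"

lemma jacobsthal_rat_in_Nats:
  assumes "2 \<le> b"
  shows "jacobsthal_rat b k \<in> \<nat>"
proof (induction k rule: less_induct)
  case (less k)
  let ?b = "of_nat b :: rat"
  have b: "?b \<ge> 2" using assms by (metis of_nat_le_iff of_nat_numeral)
  then have nz: "?b + 1 \<noteq> 0" "?b - 1 \<noteq> 0" by simp_all
  have sq: "?b ^ 2 - 1 = (?b - 1) * (?b + 1)" by (simp add: power2_eq_square algebra_simps)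
  have nz2: "?b ^ 2 - 1 \<noteq> 0" unfolding sq using nz by simp
  consider "k = 0" | "k = 1" | i where "k = i + 2"
    by (metis One_nat_def Suc_1 add.commute add_Suc_right not0_implies_Suc add_2_eq_Suc')
  then show ?case
  proof cases
    case 1
    then show ?thesis by (simp add: jacobsthal_rat_def)
  next
    case 2
    have "(?b - 1) / ((?b - 1) * (?b + 1)) + ?b / (?b + 1) = (1 + ?b) / (?b + 1)"
      using nz by (simp only: add_divide_distrib) simp
    then have "jacobsthal_rat b 1 = 1"
      unfolding jacobsthal_rat_def sq using nz(1) by (simp add: add.commute)
    with 2 show ?thesis by simp
  next
    case 3
    have "?b ^ (i + 2) - 1 = (?b ^ i - 1) + ?b ^ i * (?b ^ 2 - 1)"
      by (simp add: power_add power2_eq_square algebra_simps)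
    then have "(?b ^ (i + 2) - 1) / (?b ^ 2 - 1) = (?b ^ i - 1) / (?b ^ 2 - 1) + ?b ^ i"
      using nz2 by (simp only: add_divide_distrib nonzero_mult_div_cancel_right[OF nz2])
    then have "jacobsthal_rat b k = jacobsthal_rat b i + ?b ^ i"
      using 3 by (simp add: jacobsthal_rat_def)
    moreover have "jacobsthal_rat b i \<in> \<nat>" using less 3 by simp
    ultimately show ?thesis by (metis Nats_add of_nat_in_Nats of_nat_power)
  qed
qed

lemma of_nat_jacobsthal:
  assumes "2 \<le> b"
  shows "of_nat (jacobsthal b k) = jacobsthal_rat b k"
  using jacobsthal_rat_in_Nats[OF assms, of k] by (auto simp: jacobsthal_def elim!: Nats_cases)

end

theory Submission imports Defs begin

text \<open>Splitting off the last base-\<open>b\<close> digit of the Jacobsthal numbers gives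
  \<open>a\<^bsub>2l+1\<^esub> = b a\<^bsub>2l\<^esub> + 1\<close> and \<open>a\<^bsub>2l+2\<^esub> = b (a\<^bsub>2l+1\<^esub> - 1) + 1\<close>. So both numbers
  are congruent to \<open>1\<close> modulo \<open>b\<close>, and the two-term rule of the Stern recursion applies to each.
  In either case one of the two resulting indices is again a Jacobsthal number, and the other one
  is a neighbour of it that is not congruent to \<open>1\<close>:
  \<open>a\<^bsub>2l\<^esub> + 1 = b (a\<^bsub>2l-1\<^esub> - 1) + 1 + 1\<close> and
  \<open>a\<^bsub>2l+1\<^esub> - 1 = b (a\<^bsub>2l\<^esub> - 1) + (b - 1) + 1\<close>. The one-term rule, with the digits \<open>1\<close>
  and \<open>b - 1\<close>, reduces it to the preceding Jacobsthal number (lemmas \<open>stern_two_digits_low\<close> and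
  \<open>stern_two_digits_high\<close>).

  The second step takes place inside the substitution \<open>z\<^sub>j \<mapsto> z\<^sub>j ^ t\<^sub>j\<close> made by the first one.
  It can be pulled out because substitution is a ring homomorphism, and doing this substitution
  twice is the substitution \<open>z\<^sub>j \<mapsto> z\<^sub>j ^ (t\<^sub>j ^ 2)\<close>
  (lemma \<open>poly_subst_powers_twice\<close>).\<close>

section \<open>Substitution is a ring homomorphism\<close>

definition monomial_value :: "(nat \<Rightarrow> int_mpoly) \<Rightarrow> (nat \<Rightarrow>\<^sub>0 nat) \<Rightarrow> int_mpoly" where
  "monomial_value f m = (\<Prod>j\<in>Poly_Mapping.keys m. f j ^ Poly_Mapping.lookup m j)"

lemma monomial_value_superset:
  assumes "finite S" "Poly_Mapping.keys m \<subseteq> S"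
  shows "monomial_value f m = (\<Prod>j\<in>S. f j ^ Poly_Mapping.lookup m j)"
  unfolding monomial_value_def
  using assms by (intro prod.mono_neutral_left) (auto simp: in_keys_iff)

lemma monomial_value_add:
  "monomial_value f (m + n) = monomial_value f m * monomial_value f n"
proof -
  let ?S = "Poly_Mapping.keys m \<union> Poly_Mapping.keys n"
  have "Poly_Mapping.keys (m + n) \<subseteq> ?S" by (rule Poly_Mapping.keys_add)
  then show ?thesis
    by (simp add: monomial_value_superset[of ?S] lookup_add power_add prod.distrib)
qed

lemma poly_subst_superset:
  assumes "finite S" "Poly_Mapping.keys p \<subseteq> S"
  shows "poly_subst f p = (\<Sum>m\<in>S. of_int (Poly_Mapping.lookup p m) * monomial_value f m)"
  unfolding poly_subst_def monomial_value_def[symmetric]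
  using assms by (intro sum.mono_neutral_left) (auto simp: in_keys_iff)

lemma poly_subst_add: "poly_subst f (p + q) = poly_subst f p + poly_subst f q"
proof -
  let ?S = "Poly_Mapping.keys p \<union> Poly_Mapping.keys q"
  have "Poly_Mapping.keys (p + q) \<subseteq> ?S" by (rule Poly_Mapping.keys_add)
  then show ?thesis
    by (simp add: poly_subst_superset[of ?S] lookup_add distrib_right sum.distrib)
qed

lemma poly_subst_single:
  "poly_subst f (Poly_Mapping.single m c) = of_int c * monomial_value f m"
  by (subst poly_subst_superset[of "{m}"]) auto

lemma poly_subst_0: "poly_subst f 0 = 0"
  by (simp add: poly_subst_def)

lemma poly_subst_of_int: "poly_subst f (of_int c) = of_int c"
  by (simp add: poly_subst_single monomial_value_def flip: single_of_int)

lemma poly_subst_1: "poly_subst f 1 = 1"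
  using poly_subst_of_int[of f 1] by simp

lemma poly_subst_Z: "poly_subst f (Z j) = f j"
  by (simp add: Z_def poly_subst_single monomial_value_def)

lemma poly_subst_sum: "poly_subst f (sum g A) = (\<Sum>x\<in>A. poly_subst f (g x))"
  by (induction A rule: infinite_finite_induct) (simp_all add: poly_subst_0 poly_subst_add)

text \<open>Writing \<open>p\<close> and \<open>q\<close> as sums of single terms reduces the claim to a product of two single terms,
  where it is the exponent law \<open>monomial_value_add\<close>.\<close>

lemma poly_subst_mult: "poly_subst f (p * q) = poly_subst f p * poly_subst f q"
proof -
  let ?term = "\<lambda>p m. Poly_Mapping.single m (Poly_Mapping.lookup p m) :: int_mpoly"
  have terms: "p = (\<Sum>m\<in>Poly_Mapping.keys p. ?term p m)" for p :: int_mpoly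
    by (rule poly_mapping_eqI) (simp add: lookup_sum lookup_single when_def in_keys_iff)
  have "poly_subst f (p * q) =
      poly_subst f ((\<Sum>m\<in>Poly_Mapping.keys p. ?term p m) * (\<Sum>n\<in>Poly_Mapping.keys q. ?term q n))"
    using terms[of p] terms[of q] by simp
  also have "\<dots> = (\<Sum>m\<in>Poly_Mapping.keys p. poly_subst f (?term p m))
      * (\<Sum>n\<in>Poly_Mapping.keys q. poly_subst f (?term q n))"
    by (simp add: sum_product poly_subst_sum mult_single poly_subst_single monomial_value_add
        mult_ac)
  also have "\<dots> = poly_subst f p * poly_subst f q"
    using terms[of p] terms[of q] by (simp flip: poly_subst_sum)
  finally show ?thesis .
qed

lemma poly_subst_power: "poly_subst f (p ^ k) = poly_subst f p ^ k"
  by (induction k) (simp_all add: poly_subst_1 poly_subst_mult)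

lemma poly_subst_prod: "poly_subst f (prod g A) = (\<Prod>x\<in>A. poly_subst f (g x))"
  by (induction A rule: infinite_finite_induct) (simp_all add: poly_subst_1 poly_subst_mult)

lemma poly_subst_poly_subst:
  "poly_subst g (poly_subst f p) = poly_subst (\<lambda>j. poly_subst g (f j)) p"
  by (simp add: poly_subst_def[of f] poly_subst_def[of "\<lambda>j. poly_subst g (f j)"]
      poly_subst_sum poly_subst_mult poly_subst_of_int poly_subst_prod poly_subst_power)

lemma poly_subst_powers_twice:
  "poly_subst (\<lambda>i. Z i ^ t i) (poly_subst (\<lambda>i. Z i ^ t i) p) = poly_subst (\<lambda>i. Z i ^ (t i ^ 2)) p"
  by (simp add: poly_subst_poly_subst poly_subst_power poly_subst_Z power2_eq_square
      flip: power_mult)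

section \<open>Two steps of the Stern recursion\<close>

text \<open>The index is \<open>b m + 1\<close> with \<open>m = b (n - 1) + 1\<close>, so its two-term rule involves \<open>m\<close> itself
  and \<open>m + 1 = b (n - 1) + 1 + 1\<close>, to which the digit \<open>1\<close> is attached.\<close>

lemma stern_two_digits_low:
  assumes "2 \<le> b" "1 \<le> n" "m = b * (n - 1) + 1"
  shows "stern b t (b * m + 1) =
    Z b * poly_subst (\<lambda>i. Z i ^ t i) (stern b t m)
    + Z 1 ^ t 1 * poly_subst (\<lambda>i. Z i ^ (t i ^ 2)) (stern b t n)"
proof -
  have "stern b t (m + 1) = Z 1 * poly_subst (\<lambda>i. Z i ^ t i) (stern b t n)"
    using stern_rec_digit[of b n 1 t] assms by simp
  moreover have "stern b t (b * m + 1) = Z b * poly_subst (\<lambda>i. Z i ^ t i) (stern b t m)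
      + poly_subst (\<lambda>i. Z i ^ t i) (stern b t (m + 1))"
    using assms by (intro stern_rec_one) auto
  ultimately show ?thesis
    by (simp add: poly_subst_mult poly_subst_Z poly_subst_powers_twice)
qed

text \<open>The index is \<open>b (m - 1) + 1\<close> with \<open>m = b n + 1\<close>, so its two-term rule involves \<open>m\<close> itself
  and \<open>m - 1 = b (n - 1) + (b - 1) + 1\<close>, to which the digit \<open>b - 1\<close> is attached.\<close>

lemma stern_two_digits_high:
  assumes "2 \<le> b" "1 \<le> n" "m = b * n + 1"
  shows "stern b t (b * (m - 1) + 1) =
    poly_subst (\<lambda>i. Z i ^ t i) (stern b t m)
    + Z b * Z (b - 1) ^ t (b - 1) * poly_subst (\<lambda>i. Z i ^ (t i ^ 2)) (stern b t n)"
proof -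
  have "b * (n - 1) + (b - 1) + 1 = m - 1"
    using assms by (cases n) auto
  then have "stern b t (m - 1) = Z (b - 1) * poly_subst (\<lambda>i. Z i ^ t i) (stern b t n)"
    using stern_rec_digit[of b n "b - 1" t] assms by simp
  moreover have "stern b t (b * (m - 1) + 1) = Z b * poly_subst (\<lambda>i. Z i ^ t i) (stern b t (m - 1))
      + poly_subst (\<lambda>i. Z i ^ t i) (stern b t m)"
    using stern_rec_one[of b "m - 1" t] assms by simp
  ultimately show ?thesis
    by (simp add: poly_subst_mult poly_subst_Z poly_subst_powers_twice mult.assoc)
qed

section \<open>The last digit of the Jacobsthal numbers\<close>

lemma jacobsthal_rat_odd_step:
  assumes "2 \<le> b"
  shows "jacobsthal_rat b (2 * l + 1) = of_nat b * jacobsthal_rat b (2 * l) + 1"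
proof -
  let ?b = "of_nat b :: rat"
  have b: "?b \<ge> 2" using assms by (metis of_nat_le_iff of_nat_numeral)
  then have nz: "?b + 1 \<noteq> 0" "?b - 1 \<noteq> 0" by simp_all
  have sq: "?b ^ 2 - 1 = (?b - 1) * (?b + 1)" by (simp add: power2_eq_square algebra_simps)
  show ?thesis
    unfolding jacobsthal_rat_def sq using nz by (simp add: divide_simps) (simp add: algebra_simps)
qed

lemma jacobsthal_rat_even_step:
  assumes "2 \<le> b"
  shows "jacobsthal_rat b (2 * l + 2) = of_nat b * (jacobsthal_rat b (2 * l + 1) - 1) + 1"
proof -
  let ?b = "of_nat b :: rat"
  have b: "?b \<ge> 2" using assms by (metis of_nat_le_iff of_nat_numeral)
  then have nz: "?b + 1 \<noteq> 0" "?b - 1 \<noteq> 0" by simp_all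
  have sq: "?b ^ 2 - 1 = (?b - 1) * (?b + 1)" by (simp add: power2_eq_square algebra_simps)
  show ?thesis
    unfolding jacobsthal_rat_def sq using nz by (simp add: divide_simps) (simp add: algebra_simps)
qed

lemma jacobsthal_odd:
  assumes "2 \<le> b"
  shows "jacobsthal b (2 * l + 1) = b * jacobsthal b (2 * l) + 1"
proof -
  have "(of_nat (jacobsthal b (2 * l + 1)) :: rat) = of_nat (b * jacobsthal b (2 * l) + 1)"
    using jacobsthal_rat_odd_step[OF assms, of l] by (simp add: of_nat_jacobsthal[OF assms])
  then show ?thesis by (simp only: of_nat_eq_iff)
qed

lemma jacobsthal_even:
  assumes "2 \<le> b"
  shows "jacobsthal b (2 * l + 2) = b * (jacobsthal b (2 * l + 1) - 1) + 1"
proof -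
  have "1 \<le> jacobsthal b (2 * l + 1)"
    using jacobsthal_odd[OF assms, of l] by simp
  then have "(of_nat (jacobsthal b (2 * l + 2)) :: rat)
      = of_nat (b * (jacobsthal b (2 * l + 1) - 1) + 1)"
    using jacobsthal_rat_even_step[OF assms, of l]
    by (simp add: of_nat_diff of_nat_jacobsthal[OF assms])
  then show ?thesis by (simp only: of_nat_eq_iff)
qed

section \<open>The recurrences at the Jacobsthal numbers\<close>

theorem theorem9:
  fixes b :: nat and t :: "nat \<Rightarrow> nat"
  assumes "2 \<le> b" and "\<forall>j\<in>{1..b}. 0 < t j"
  shows "(\<forall>l\<ge>2. stern b t (jacobsthal b (2 * l + 1)) =
            Z b * poly_subst (\<lambda>j. Z j ^ t j) (stern b t (jacobsthal b (2 * l)))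
            + Z 1 ^ t 1 * poly_subst (\<lambda>j. Z j ^ (t j ^ 2)) (stern b t (jacobsthal b (2 * l - 1))))
       \<and> (\<forall>l\<ge>1. stern b t (jacobsthal b (2 * l + 2)) =
            poly_subst (\<lambda>j. Z j ^ t j) (stern b t (jacobsthal b (2 * l + 1)))
            + Z b * Z (b - 1) ^ t (b - 1)
              * poly_subst (\<lambda>j. Z j ^ (t j ^ 2)) (stern b t (jacobsthal b (2 * l))))"
proof (intro conjI allI impI)
  fix l :: nat
  assume "2 \<le> l"
  then have l: "2 * l = 2 * (l - 1) + 2" "2 * l - 1 = 2 * (l - 1) + 1" by simp_all
  have "1 \<le> jacobsthal b (2 * l - 1)"
    unfolding l using jacobsthal_odd[OF assms(1), of "l - 1"] by simp
  moreover have "jacobsthal b (2 * l) = b * (jacobsthal b (2 * l - 1) - 1) + 1"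
    using jacobsthal_even[OF assms(1), of "l - 1"] l by simp
  ultimately show "stern b t (jacobsthal b (2 * l + 1)) =
      Z b * poly_subst (\<lambda>j. Z j ^ t j) (stern b t (jacobsthal b (2 * l)))
      + Z 1 ^ t 1 * poly_subst (\<lambda>j. Z j ^ (t j ^ 2)) (stern b t (jacobsthal b (2 * l - 1)))"
    unfolding jacobsthal_odd[OF assms(1), of l] by (rule stern_two_digits_low[OF assms(1)])
next
  fix l :: nat
  assume "1 \<le> l"
  then have "2 * l = 2 * (l - 1) + 2" by simp
  then have "1 \<le> jacobsthal b (2 * l)"
    using jacobsthal_even[OF assms(1), of "l - 1"] by simp
  then show "stern b t (jacobsthal b (2 * l + 2)) =
      poly_subst (\<lambda>j. Z j ^ t j) (stern b t (jacobsthal b (2 * l + 1)))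
      + Z b * Z (b - 1) ^ t (b - 1)
        * poly_subst (\<lambda>j. Z j ^ (t j ^ 2)) (stern b t (jacobsthal b (2 * l)))"
    unfolding jacobsthal_even[OF assms(1), of l]
    using jacobsthal_odd[OF assms(1), of l] by (rule stern_two_digits_high[OF assms(1)])
qed

end
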